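(* Let $m$ be a positive integer. Then $$\zeta_h(2m) = -\frac{1}{2}\sum_{k=1}^{m}\left(2^{2k+1}-1\right)\zeta(2m-2k)\,\zeta(2k+1),$$ where $\zeta_h(s) := \sum_{n=1}^\infty h_n/n^s$ for $\Re s>1$ and where $\zeta(0) = -1/2$.
   Context: For a positive integer $n$, $h_n := \sum_{k=1}^n \frac{1}{2k-1}$. $\zeta$ denotes the Riemann zeta function. *)

theory Defs
  imports "HOL-Complex_Analysis.Complex_Analysis"
begin

definition odd_harm :: "nat \<Rightarrow> real" where
  "odd_harm n = (\<Sum>k=1..n. 1 / (2 * real k - 1))"

(* The meromorphic continuation of the Dirichlet series is determined everywhere except at its
   pole s = 1, where the value chosen here is unspecified. *)
definition riemann_zeta :: "complex \<Rightarrow> complex" where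
  "riemann_zeta = (SOME f. f holomorphic_on (- {1}) \<and>
     (\<forall>s. Re s > 1 \<longrightarrow> f s = (\<Sum>n. 1 / of_nat (Suc n) powr s)))"

(* Meaningful only for Re s > 1, where the series converges absolutely. *)
definition zeta_h :: "complex \<Rightarrow> complex" where
  "zeta_h s = (\<Sum>n. of_real (odd_harm (Suc n)) / of_nat (Suc n) powr s)"

end

theory Submission
  imports Defs "HOL-Real_Asymp.Real_Asymp"
begin

text \<open>
  For \<open>p \<ge> 2\<close> the number \<open>(2 ^ p - 1) * zeta(p)\<close> is the sum of \<open>a\<^sup>-\<^sup>p\<close> over the positive
  half-integers \<open>a = j + 1/2\<close> (lemma \<open>half_integer_sums\<close>). The terms \<open>1 \<le> k < m\<close> of the right-hand
  side therefore form one double series over half-integers \<open>a\<close> and positive integers \<open>b\<close>, whose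
  summand is a finite geometric sum in \<open>k\<close>. It collapses
  (\<open>geometric_sum_double_kernel\<close>) to the difference of \<open>b\<^sup>2\<^sup>-\<^sup>2\<^sup>m K(a,b)\<close> and
  \<open>a\<^sup>2\<^sup>-\<^sup>2\<^sup>m K(a,b)\<close> with the kernel \<open>K(a,b) = 1 / (a (a\<^sup>2 - b\<^sup>2))\<close>; its denominator never
  vanishes because a half-integer is not an integer.

  The kernel is absolutely summable (\<open>double_kernel_summable\<close>), so the two parts may be summed
  separately and each in its own order. Both inner sums telescope, because adding half-integers
  and integers gives half-integers again: \<open>K(a,b)\<close> summed over \<open>a\<close> is \<open>- 2 h\<^sub>b / b\<^sup>2\<close>,
  which brings in \<open>h\<^sub>b\<close>, and \<open>1 / (a\<^sup>2 - b\<^sup>2)\<close> summed over \<open>b\<close> is \<open>- 1 / (2 a\<^sup>2)\<close>, which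
  yields a multiple of \<open>zeta(2m+1)\<close>. This is \<open>odd_harm_series\<close>. The term \<open>k = m\<close> supplies exactly
  that multiple, since \<open>zeta(0) = -1/2\<close>.

  The value at \<open>0\<close> requires the analytic continuation. As \<open>riemann_zeta\<close> is a choice among all
  functions with the right values for \<open>Re s > 1\<close> and holomorphic off \<open>1\<close>, nothing is known about it
  until one such function has been constructed on the whole punctured plane. Writing
  \<open>u = 1 - s\<close>, a Taylor expansion of \<open>(n+1)\<^sup>u\<close> around \<open>n\<close>, summed over \<open>n\<close>, expresses a combination
  of \<open>F(s), F(s+1), \<dots>, F(s+K-1)\<close>, where \<open>F(s) = (s - 1) zeta(s)\<close>, by a remainder series that
  converges for \<open>Re s > 1 - K\<close> (\<open>zeta_series_recursion\<close>). This extends \<open>F\<close> half-plane by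
  half-plane to an entire function, and the same identity gives \<open>F(1)\<close> and \<open>F(0)\<close>, because the
  remainder vanishes where the Taylor polynomial is exact.
\<close>

section \<open>Continuation of zeta and its value at zero\<close>

definition zeta_series :: "complex \<Rightarrow> complex" where
  "zeta_series s = (\<Sum>n. 1 / of_nat (Suc n) powr s)"

text \<open>The remainder of the Taylor expansion of \<open>x\<^sup>u\<close> around \<open>x = n + 1\<close> to order \<open>K\<close>, evaluated at
  the next integer \<open>n + 2\<close>. The index is shifted so that \<open>n\<close> ranges over all natural numbers.\<close>
definition taylor_rem :: "nat \<Rightarrow> complex \<Rightarrow> nat \<Rightarrow> complex" where
  "taylor_rem K u n = of_nat (n + 2) powr u
     - (\<Sum>k\<le>K. (u gchoose k) * of_nat (Suc n) powr (u - of_nat k))"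

lemma fact_gbinomial_Suc:
  "fact (Suc i) * (u gchoose Suc i) = fact i * (u gchoose i) * (u - of_nat i)"
  for u :: complex
  by (simp only: gbinomial_mult_fact prod.atLeast0_lessThan_Suc)

text \<open>Each derivative lowers the exponent of \<open>x\<^sup>u\<close> by one, so the remainder of order \<open>K\<close> decays
  like \<open>n\<close> to the power \<open>Re u - K - 1\<close>: raising \<open>K\<close> makes its sum over \<open>n\<close> converge on larger
  half-planes. The hypothesis makes the bounding power non-increasing in \<open>x\<close>, hence largest at the left end of
  the segment.\<close>
lemma taylor_rem_bound:
  assumes "Re u \<le> real (Suc K)"
  shows "cmod (taylor_rem K u n)
    \<le> cmod (fact (Suc K) * (u gchoose Suc K)) / fact K * real (Suc n) powr (Re u - real (Suc K))"
proof -
  define f where "f = (\<lambda>i (x::complex). fact i * (u gchoose i) * x powr (u - of_nat i))"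
  define S where "S = closed_segment (complex_of_real (real (Suc n))) (of_real (real (n + 2)))"
  define B where "B = cmod (fact (Suc K) * (u gchoose Suc K)) * real (Suc n) powr (Re u - real (Suc K))"
  have S: "\<exists>r. x = of_real r \<and> r \<ge> real (Suc n)" if "x \<in> S" for x
  proof -
    have "S = complex_of_real ` {real (Suc n)..real (n + 2)}"
      unfolding S_def closed_segment_of_real by (simp add: closed_segment_eq_real_ivl)
    then show ?thesis using that by auto
  qed
  have pos: "x \<notin> \<real>\<^sub>\<le>\<^sub>0" if "x \<in> S" for x
    using S[OF that] by (auto simp: complex_nonpos_Reals_iff)
  have der: "(f i has_field_derivative f (Suc i) x) (at x within S)" if "x \<in> S" for i x
  proof -
    have "((\<lambda>x. fact i * (u gchoose i) * x powr (u - of_nat i)) has_field_derivative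
       fact i * (u gchoose i) * ((u - of_nat i) * x powr (u - of_nat i - 1))) (at x within S)"
      by (intro DERIV_cmult has_field_derivative_at_within[OF has_field_derivative_powr] pos that)
    moreover have "fact i * (u gchoose i) * ((u - of_nat i) * x powr (u - of_nat i - 1)) = f (Suc i) x"
      unfolding f_def fact_gbinomial_Suc by (simp add: algebra_simps)
    ultimately show ?thesis by (simp add: f_def)
  qed
  have bnd: "cmod (f (Suc K) x) \<le> B" if "x \<in> S" for x
  proof -
    obtain r where r: "x = of_real r" "r \<ge> real (Suc n)" using S[OF \<open>x \<in> S\<close>] by auto
    have "cmod (x powr (u - of_nat (Suc K))) = r powr (Re u - real (Suc K))"
      using r by (subst norm_powr_real_powr) auto
    also have "\<dots> \<le> real (Suc n) powr (Re u - real (Suc K))"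
      using r assms by (intro powr_mono2') auto
    finally show ?thesis
      unfolding f_def B_def norm_mult by (intro mult_left_mono) auto
  qed
  have "cmod (f 0 (of_real (real (n + 2))) - (\<Sum>i\<le>K. f i (of_real (real (Suc n)))
          * (of_real (real (n + 2)) - of_real (real (Suc n))) ^ i / fact i))
        \<le> B * cmod (of_real (real (n + 2)) - of_real (real (Suc n))) ^ Suc K / fact K"
    by (rule complex_Taylor[of S K f B]) (auto simp: S_def[symmetric] der bnd, auto simp: S_def)
  also have "f 0 (of_real (real (n + 2))) - (\<Sum>i\<le>K. f i (of_real (real (Suc n)))
          * (of_real (real (n + 2)) - of_real (real (Suc n))) ^ i / fact i) = taylor_rem K u n"
    by (simp add: f_def taylor_rem_def)
  finally show ?thesis by (simp add: B_def)
qed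

lemma summable_Suc_powr: "e < -1 \<Longrightarrow> summable (\<lambda>n. real (Suc n) powr e)"
  using summable_Suc_iff[of "\<lambda>n. real n powr e"] by (simp add: summable_real_powr_iff)

lemma holomorphic_gbinomial: "(\<lambda>s::complex. (1 - s) gchoose k) holomorphic_on A"
  unfolding gbinomial_prod_rev by (intro holomorphic_intros) auto

lemma holomorphic_taylor_rem: "(\<lambda>s. taylor_rem K (1 - s) n) holomorphic_on A"
  unfolding taylor_rem_def by (intro holomorphic_intros holomorphic_gbinomial)

lemma suminf_taylor_rem_holomorphic:
  "(\<lambda>s. \<Sum>n. taylor_rem K (1 - s) n) holomorphic_on {s. Re s > 1 - real K}"
proof -
  let ?S = "{s. Re s > 1 - real K}"
  have op: "open ?S" by (simp add: open_halfspace_Re_gt)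
  have dom: "\<exists>d h. 0 < d \<and> summable h \<and> range h \<subseteq> \<real>\<^sub>\<ge>\<^sub>0 \<and>
      (\<forall>\<^sub>F n in sequentially. \<forall>y\<in>ball x d \<inter> ?S. cmod (taylor_rem K (1 - y) n) \<le> cmod (h n))"
    if x: "x \<in> ?S" for x
  proof -
    \<comment> \<open>Half the distance to the boundary line, so that on the disc the terms are dominated by \<open>C * (n + 1) powr (- 1 - d)\<close>.\<close>
    define d where "d = (Re x - (1 - real K)) / 2"
    have d: "d > 0" using x by (simp add: d_def)
    define c where "c = (\<lambda>y. cmod (fact (Suc K) * ((1 - y) gchoose Suc K)) / fact K)"
    have "continuous_on (cball x d) c"
      unfolding c_def
      by (intro continuous_intros holomorphic_on_imp_continuous_on[OF holomorphic_gbinomial]) auto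
    then have "bdd_above (c ` cball x d)"
      by (intro bounded_imp_bdd_above compact_imp_bounded compact_continuous_image) auto
    then obtain C where C: "\<And>y. y \<in> cball x d \<Longrightarrow> c y \<le> C"
      unfolding bdd_above_def by blast
    have C0: "C \<ge> 0" using C[of x] d by (simp add: c_def order_trans[rotated])
    define h where "h = (\<lambda>n. complex_of_real (C * real (Suc n) powr (-1 - d)))"
    have "cmod (taylor_rem K (1 - y) n) \<le> cmod (h n)" if y: "y \<in> ball x d \<inter> ?S" for y n
    proof -
      have "\<bar>Re y - Re x\<bar> < d"
        using y abs_Re_le_cmod[of "y - x"] by (auto simp: dist_norm norm_minus_commute)
      then have "Re y > Re x - d" by linarith
      moreover have "Re x = 1 - real K + 2 * d" by (simp add: d_def field_simps)
      ultimately have e: "Re (1 - y) - real (Suc K) \<le> -1 - d" by simp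
      have "cmod (taylor_rem K (1 - y) n) \<le> c y * real (Suc n) powr (Re (1 - y) - real (Suc K))"
        unfolding c_def using y by (intro taylor_rem_bound) auto
      also have "\<dots> \<le> C * real (Suc n) powr (-1 - d)"
        using e C0 C[of y] y by (intro mult_mono powr_mono) (auto simp: c_def)
      finally show ?thesis using C0 by (simp add: h_def norm_mult)
    qed
    moreover have "summable h"
      unfolding h_def using d by (intro summable_of_real summable_mult summable_Suc_powr) auto
    moreover have "range h \<subseteq> \<real>\<^sub>\<ge>\<^sub>0" using C0 by (auto simp: h_def simp del: of_real_mult)
    ultimately show ?thesis using d by (intro exI[of _ d] exI[of _ h]) auto
  qed
  have diff: "(\<lambda>s. taylor_rem K (1 - s) n) field_differentiable (at x)" for n x
    using holomorphic_on_imp_differentiable_at[OF holomorphic_taylor_rem open_UNIV] by auto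
  obtain g where
    g: "\<forall>x\<in>?S. (\<lambda>n. taylor_rem K (1 - x) n) sums g x \<and> g field_differentiable (at x)"
    by (rule series_differentiable_comparison_complex[OF op diff dom])
  then have "g holomorphic_on ?S"
    by (auto simp: holomorphic_on_def intro: field_differentiable_at_within)
  then show ?thesis
    by (rule holomorphic_transform) (use g in \<open>auto simp: sums_iff\<close>)
qed

lemma zeta_series_sums:
  assumes "Re s > 1"
  shows "(\<lambda>n. of_nat (Suc n) powr (- s)) sums zeta_series s"
proof -
  have "cmod (of_nat (Suc n) powr (- s)) = real (Suc n) powr (- Re s)" for n
    by (subst norm_powr_real_powr) auto
  then have "summable (\<lambda>n. cmod (of_nat (Suc n) powr (- s)))"
    using summable_Suc_powr[of "- Re s"] assms by simp
  then have "summable (\<lambda>n. of_nat (Suc n) powr (- s))" by (rule summable_norm_cancel)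
  then show ?thesis
    unfolding zeta_series_def powr_minus_divide by (rule summable_sums)
qed

text \<open>Summing \<open>(n+1)\<^sup>u - n\<^sup>u\<close> with \<open>u = 1 - s\<close> over all \<open>n \<ge> 1\<close> telescopes to \<open>-1\<close>. Replacing each
  difference by its Taylor polynomial plus remainder turns the powers of \<open>n\<close> into values of the zeta
  series at \<open>s, s+1, \<dots>\<close>. The coefficient of \<open>zeta(s + k)\<close> contains the factor \<open>s + k - 1\<close>,
  which cancels the pole; in terms of \<open>(s - 1) zeta(s)\<close> all coefficients are therefore polynomials
  in \<open>s\<close>.\<close>
lemma zeta_series_recursion:
  assumes s: "Re s > 1"
  shows "(\<Sum>k<K. ((1 - s) gchoose k) / of_nat (Suc k) * ((s + of_nat k - 1) * zeta_series (s + of_nat k)))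
    = 1 + (\<Sum>n. taylor_rem K (1 - s) n)"
proof -
  define u where "u = 1 - s"
  define f where "f = (\<lambda>n. complex_of_nat (Suc n) powr u)"
  have "f \<longlonglongrightarrow> 0"
  proof (rule tendsto_norm_zero_cancel)
    have "(\<lambda>n. real n powr Re u) \<longlonglongrightarrow> 0"
      using s by (intro tendsto_neg_powr filterlim_real_sequentially) (auto simp: u_def)
    then have "(\<lambda>n. real (Suc n) powr Re u) \<longlonglongrightarrow> 0" by (rule LIMSEQ_Suc)
    moreover have "cmod (f n) = real (Suc n) powr Re u" for n
      unfolding f_def by (subst norm_powr_real_powr) auto
    ultimately show "(\<lambda>n. cmod (f n)) \<longlonglongrightarrow> 0" by simp
  qed
  from telescope_sums[OF this] have A: "(\<lambda>n. f (Suc n) - f n) sums (-1)"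
    by (simp add: f_def)
  have B: "(\<lambda>n. of_nat (Suc n) powr (u - of_nat (Suc k))) sums zeta_series (s + of_nat k)" for k
    using zeta_series_sums[of "s + of_nat k"] s by (simp add: u_def algebra_simps)
  have "taylor_rem K u = (\<lambda>n. f (Suc n) - f n - (\<Sum>k<K. (u gchoose Suc k) * of_nat (Suc n) powr (u - of_nat (Suc k))))"
    by (simp add: fun_eq_iff taylor_rem_def f_def sum.atMost_shift)
  then have "taylor_rem K u sums (-1 - (\<Sum>k<K. (u gchoose Suc k) * zeta_series (s + of_nat k)))"
    by (simp only:) (intro sums_diff A sums_sum sums_mult B)
  moreover have "(u gchoose Suc k) = - ((u gchoose k) / of_nat (Suc k) * (s + of_nat k - 1))" for k
    using gbinomial_mult_1[of u k] by (simp add: u_def field_simps del: of_nat_Suc)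
  ultimately show ?thesis
    by (simp add: u_def sums_iff sum_negf mult.assoc)
qed

text \<open>The factor \<open>s - 1\<close> removes the pole, so a continuation in this sense can be entire.\<close>
definition continues_zeta :: "(complex \<Rightarrow> complex) \<Rightarrow> bool" where
  "continues_zeta F \<longleftrightarrow> (\<forall>s. Re s > 1 \<longrightarrow> F s = (s - 1) * zeta_series s)"

lemma continues_zeta_recursion:
  assumes "continues_zeta F" "Re s > 1"
  shows "(\<Sum>k<K. ((1 - s) gchoose k) / of_nat (Suc k) * F (s + of_nat k)) = 1 + (\<Sum>n. taylor_rem K (1 - s) n)"
  using zeta_series_recursion[OF assms(2), of K] assms by (simp add: continues_zeta_def)

lemma continuation_unique:
  assumes "F holomorphic_on {s. Re s > c}" "G holomorphic_on {s. Re s > c}"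
    and "\<And>s. Re s > 1 \<Longrightarrow> F s = G s" and "c \<le> 1" "Re z > c"
  shows "F z = G z"
proof (rule analytic_continuation_open[of "{s. Re s > 1}" "{s. Re s > c}" F G])
  have "(2::complex) \<in> {s. Re s > 1}" by simp
  then show "{s. Re s > 1} \<noteq> {}" by blast
qed (use assms in \<open>auto simp: open_halfspace_Re_gt convex_connected convex_halfspace_Re_gt\<close>)

lemma holomorphic_shift:
  assumes "F holomorphic_on {s. Re s > c + real k}"
  shows "(\<lambda>s. F (s + of_nat k)) holomorphic_on {s. Re s > c}"
proof -
  have "F \<circ> (\<lambda>s. s + of_nat k) holomorphic_on {s. Re s > c}"
    by (rule holomorphic_on_compose_gen[OF _ assms]) (auto intro!: holomorphic_intros)
  then show ?thesis by (simp add: o_def)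
qed

text \<open>The recursion of order \<open>K + 2\<close>, solved for its term \<open>k = 0\<close>, defines \<open>F(s)\<close> through \<open>F(s+1), F(s+2), \<dots>\<close> and
  a remainder series, and so gains one unit of width to the left. At order \<open>1\<close> no other value of \<open>F\<close>
  occurs, which starts the induction.\<close>
lemma continuation_half_plane:
  "\<exists>F. F holomorphic_on {s. Re s > - real K} \<and> continues_zeta F"
proof (induction K)
  case 0
  define G where "G = (\<lambda>s. 1 + (\<Sum>n. taylor_rem 1 (1 - s) n))"
  have "G holomorphic_on {s. Re s > - real 0}"
    unfolding G_def using suminf_taylor_rem_holomorphic[of 1] by (auto intro!: holomorphic_intros)
  moreover have "continues_zeta G"
    using continues_zeta_recursion[of "\<lambda>s. (s - 1) * zeta_series s" _ 1]
    by (simp add: continues_zeta_def G_def)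
  ultimately show ?case by blast
next
  case (Suc K)
  then obtain F where F: "F holomorphic_on {s. Re s > - real K}" "continues_zeta F" by blast
  define G where "G = (\<lambda>s. 1 + (\<Sum>n. taylor_rem (Suc (Suc K)) (1 - s) n)
     - (\<Sum>k<Suc K. ((1 - s) gchoose Suc k) / of_nat (Suc (Suc k)) * F (s + of_nat (Suc k))))"
  have sh: "(\<lambda>s. F (s + of_nat (Suc k))) holomorphic_on {s. Re s > - real (Suc K)}" for k
    by (intro holomorphic_shift holomorphic_on_subset[OF F(1)]) auto
  have "G holomorphic_on {s. Re s > - real (Suc K)}"
    unfolding G_def using suminf_taylor_rem_holomorphic[of "Suc (Suc K)"]
    by (intro holomorphic_intros holomorphic_gbinomial sh) auto
  moreover have "continues_zeta G"
    unfolding continues_zeta_def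
  proof (intro allI impI)
    fix s :: complex assume s: "Re s > 1"
    have "F s + (\<Sum>k<Suc K. ((1 - s) gchoose Suc k) / of_nat (Suc (Suc k)) * F (s + of_nat (Suc k)))
      = 1 + (\<Sum>n. taylor_rem (Suc (Suc K)) (1 - s) n)"
      using continues_zeta_recursion[OF F(2) s, of "Suc (Suc K)"]
      by (subst (asm) sum.lessThan_Suc_shift) simp
    then have "F s = G s" by (simp only: G_def eq_diff_eq)
    then show "G s = (s - 1) * zeta_series s" using F(2) s by (simp add: continues_zeta_def)
  qed
  ultimately show ?case by blast
qed

text \<open>The continuations to the growing half-planes agree by the identity theorem and can be glued.\<close>
lemma continuation_entire: "\<exists>F. F holomorphic_on UNIV \<and> continues_zeta F"
proof -
  obtain F where F: "\<And>K. F K holomorphic_on {s. Re s > - real K}" "\<And>K. continues_zeta (F K)"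
    using continuation_half_plane by metis
  define N where "N = (\<lambda>s. Suc (nat \<lceil>- Re s\<rceil>))"
  define G where "G = (\<lambda>s. F (N s) s)"
  have N: "Re s > - real (N s)" for s
    unfolding N_def by linarith
  have eq: "G s = F K s" if "Re s > - real K" for s K
    unfolding G_def
  proof (rule continuation_unique[of "F (N s)" "- real (min (N s) K)" "F K" s])
    show "F (N s) holomorphic_on {z. Re z > - real (min (N s) K)}"
      by (rule holomorphic_on_subset[OF F(1)]) auto
    show "F K holomorphic_on {z. Re z > - real (min (N s) K)}"
      by (rule holomorphic_on_subset[OF F(1)]) auto
  qed (use F(2) N[of s] that in \<open>auto simp: continues_zeta_def min_def\<close>)
  have "G holomorphic_on (\<Union>K\<in>UNIV. {s. Re s > - real K})"
    by (intro holomorphic_on_UN_open holomorphic_transform[OF F(1)])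
       (auto simp: eq open_halfspace_Re_gt)
  moreover have "(\<Union>K\<in>UNIV. {s. Re s > - real K}) = UNIV"
    using N by blast
  moreover have "continues_zeta G"
    using F(2)[of 0] by (auto simp: continues_zeta_def eq[of 0])
  ultimately show ?thesis by auto
qed

text \<open>By the identity theorem the recursion persists as far to the left as the remainder series
  converges, which includes points where the zeta series itself diverges.\<close>
lemma continuation_recursion:
  assumes F: "F holomorphic_on UNIV" "continues_zeta F" and z: "Re z > 1 - real K"
  shows "(\<Sum>k<K. ((1 - z) gchoose k) / of_nat (Suc k) * F (z + of_nat k)) = 1 + (\<Sum>n. taylor_rem K (1 - z) n)"
proof (rule continuation_unique[OF _ _ _ _ z])
  have "(\<lambda>s. F (s + of_nat k)) holomorphic_on {s. Re s > 1 - real K}" for k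
    by (intro holomorphic_shift holomorphic_on_subset[OF F(1)]) auto
  then show "(\<lambda>s. \<Sum>k<K. ((1 - s) gchoose k) / of_nat (Suc k) * F (s + of_nat k)) holomorphic_on {s. Re s > 1 - real K}"
    by (intro holomorphic_intros holomorphic_gbinomial) auto
  show "(\<lambda>s. 1 + (\<Sum>n. taylor_rem K (1 - s) n)) holomorphic_on {s. Re s > 1 - real K}"
    by (intro holomorphic_intros suminf_taylor_rem_holomorphic)
qed (use continues_zeta_recursion[OF F(2)] in auto)

text \<open>At \<open>s = 1\<close> and \<open>s = 0\<close> the expanded function is \<open>x\<^sup>0\<close> or \<open>x\<^sup>1\<close>, whose Taylor polynomials of order
  \<open>1\<close> and \<open>2\<close> are exact. The recursion then reads \<open>F(1) = 1\<close> and \<open>F(0) + F(1) / 2 = 1\<close>.\<close>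
lemma continuation_values:
  assumes "F holomorphic_on UNIV" "continues_zeta F"
  shows "F 1 = 1" "F 0 = 1 / 2"
proof -
  have "taylor_rem 1 (1 - 1) n = 0" for n
    by (simp add: taylor_rem_def del: of_nat_Suc)
  then show 1: "F 1 = 1"
    using continuation_recursion[OF assms, of 1 1] by simp
  have "(1::complex) gchoose Suc (Suc 0) = 0"
    by (simp add: gbinomial_prod_rev)
  then have "taylor_rem 2 (1 - 0) n = 0" for n
    using of_nat_neq_0[of n, where 'a = complex]
    by (simp only: taylor_rem_def numeral_2_eq_2 sum.atMost_Suc) simp
  then have "F 0 + 1 / 2 = 1"
    using continuation_recursion[OF assms, of 2 0] 1 by (simp add: numeral_2_eq_2)
  then have "F 0 = 1 - 1 / 2" by (simp only: eq_diff_eq)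
  then show "F 0 = 1 / 2" by simp
qed

text \<open>The entire continuation divided by \<open>s - 1\<close> shows that the choice defining \<open>riemann_zeta\<close> is
  among a nonempty set of functions. Connectedness of the punctured plane then transfers the value at
  \<open>0\<close> to the function actually chosen.\<close>
lemma
  shows riemann_zeta_eq_series: "Re s > 1 \<Longrightarrow> riemann_zeta s = zeta_series s"
    and riemann_zeta_0: "riemann_zeta 0 = - 1 / 2"
proof -
  obtain F where F: "F holomorphic_on UNIV" "continues_zeta F"
    using continuation_entire by blast
  have "\<exists>f. f holomorphic_on (- {1}) \<and>
     (\<forall>s. Re s > 1 \<longrightarrow> f s = (\<Sum>n. 1 / of_nat (Suc n) powr s))"
  proof (intro exI conjI allI impI)
    show "(\<lambda>s. F s / (s - 1)) holomorphic_on - {1}"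
      using F(1) by (intro holomorphic_intros) (auto intro: holomorphic_on_subset)
    show "F s / (s - 1) = (\<Sum>n. 1 / of_nat (Suc n) powr s)" if "Re s > 1" for s
    proof -
      have "s - 1 \<noteq> 0" using that by auto
      then show ?thesis using F(2) that by (simp add: continues_zeta_def zeta_series_def)
    qed
  qed
  from someI_ex[OF this] have hol: "riemann_zeta holomorphic_on - {1}"
    and ser: "\<And>s. Re s > 1 \<Longrightarrow> riemann_zeta s = zeta_series s"
    unfolding riemann_zeta_def[symmetric] zeta_series_def by auto
  show "Re s > 1 \<Longrightarrow> riemann_zeta s = zeta_series s" by (rule ser)
  have "connected (- {1::complex})"
    by (intro connected_punctured_universe) simp
  have "(0 - 1) * riemann_zeta 0 = F 0"
  proof (rule analytic_continuation_open[of "{s. Re s > 1}" "- {1}" "\<lambda>s. (s - 1) * riemann_zeta s" F 0])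
    have "(2::complex) \<in> {s. Re s > 1}" by simp
    then show "{s. Re s > 1} \<noteq> {}" by blast
    show "connected (- {1::complex})" by fact
    show "(\<lambda>s. (s - 1) * riemann_zeta s) holomorphic_on - {1}"
      by (intro holomorphic_intros hol)
    show "F holomorphic_on - {1}" using F(1) by (rule holomorphic_on_subset) auto
  qed (use F(2) ser in \<open>auto simp: continues_zeta_def open_halfspace_Re_gt open_Compl\<close>)
  then have "F 0 = - riemann_zeta 0" by simp
  then have "riemann_zeta 0 = - F 0" by simp
  then show "riemann_zeta 0 = - 1 / 2"
    by (simp add: continuation_values(2)[OF F])
qed

section \<open>Telescoping sums over integers and half-integers\<close>

definition half_harm :: "nat \<Rightarrow> real" where
  "half_harm N = (\<Sum>j<N. 1 / (real j + 1 / 2))"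

lemma half_harm_eq: "half_harm N = 2 * odd_harm N"
proof -
  have "odd_harm N = (\<Sum>j<N. 1 / (2 * real (Suc j) - 1))"
    unfolding odd_harm_def by (simp add: sum.atLeast1_atMost_eq)
  then show ?thesis
    by (simp add: half_harm_def sum_distrib_left) (simp add: field_simps)
qed

lemma half_harm_Suc: "half_harm (Suc N) = half_harm N + 1 / (real N + 1 / 2)"
  by (simp add: half_harm_def)

lemma half_harm_0 [simp]: "half_harm 0 = 0"
  by (simp add: half_harm_def)

lemma half_harm_shift_tendsto: "(\<lambda>N. half_harm (N + c) - half_harm N) \<longlonglongrightarrow> 0"
proof (induction c)
  case (Suc c)
  have "(\<lambda>N. 1 / (real (N + c) + 1 / 2)) \<longlonglongrightarrow> 0"
    by real_asymp
  from tendsto_add[OF Suc this] show ?case by (simp add: half_harm_Suc algebra_simps)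
qed simp

lemma sum_half_shift_up: "(\<Sum>i<N. 1 / (real i + 1 / 2 + real c)) = half_harm (c + N) - half_harm c"
  by (induction N) (auto simp: half_harm_Suc algebra_simps)

text \<open>The first \<open>c\<close> terms run through the negative half-integers and give \<open>- half_harm c\<close>; the others
  start again at \<open>1/2\<close>.\<close>
lemma sum_half_shift_down: "(\<Sum>i<N + c. 1 / (real i + 1 / 2 - real c)) = half_harm N - half_harm c"
proof (induction N)
  case 0
  have "(\<Sum>i<c. 1 / (real i + 1 / 2 - real c)) = (\<Sum>i<c. - (1 / (real (c - Suc i) + 1 / 2)))"
  proof (rule sum.cong)
    fix i assume "i \<in> {..<c}"
    then have "real i + 1 / 2 - real c = - (real (c - Suc i) + 1 / 2)"
      by (simp add: of_nat_diff)
    then show "1 / (real i + 1 / 2 - real c) = - (1 / (real (c - Suc i) + 1 / 2))"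
      by (simp only: divide_minus_right)
  qed simp
  also have "\<dots> = - half_harm c"
    unfolding sum_negf half_harm_def by (subst sum.nat_diff_reindex) simp
  finally show ?case by simp
qed (simp add: half_harm_Suc)

lemma half_integer_neq_nat: "real j + 1 / 2 \<noteq> real n"
proof
  assume "real j + 1 / 2 = real n"
  then have "real (2 * j + 1) = real (2 * n)" by simp
  then show False by (simp only: of_nat_eq_iff) presburger
qed

text \<open>In partial fractions the summand is a difference of reciprocals of two half-integers, one shifted
  up by \<open>j + 1\<close> and one shifted down by \<open>j\<close>. Up to a vanishing tail everything cancels except the
  reciprocal of \<open>a = j + 1/2\<close>, which the two shifts count differently.\<close>
lemma sums_over_integers:
  "(\<lambda>n. 1 / ((real j + 1 / 2)\<^sup>2 - (real (Suc n))\<^sup>2)) sums (- 1 / (2 * (real j + 1 / 2)\<^sup>2))"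
proof -
  define a where "a = real j + 1 / 2"
  have a: "a > 0" "a \<noteq> real n" for n using half_integer_neq_nat[of j n] by (auto simp: a_def)
  define g where "g = (\<lambda>n. 1 / (a\<^sup>2 - (real (Suc n))\<^sup>2))"
  have g: "g n = (1 / (real n + 1 / 2 + real (Suc j)) - 1 / (real n + 1 / 2 - real j)) / (2 * a)" for n
  proof -
    have "g n = (1 / (real (Suc n) + a) - 1 / (real (Suc n) - a)) / (2 * a)"
    proof -
      have "a\<^sup>2 - (real (Suc n))\<^sup>2 = (a - real (Suc n)) * (a + real (Suc n))"
        by (simp add: power2_eq_square algebra_simps)
      moreover have "a - real (Suc n) \<noteq> 0" "a + real (Suc n) \<noteq> 0" "real (Suc n) - a \<noteq> 0"
        using a(1) a(2)[of "Suc n"] by auto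
      ultimately show ?thesis using a(1) unfolding g_def
        by (simp add: divide_simps) (simp add: algebra_simps)
    qed
    then show ?thesis by (simp add: a_def algebra_simps)
  qed
  have step: "half_harm (Suc j) = half_harm j + 1 / a" by (simp add: half_harm_Suc a_def)
  have idx: "Suc j + (N + j) = N + (2 * j + 1)" for N by simp
  have "(\<Sum>n<N + j. g n) = ((half_harm (N + (2 * j + 1)) - half_harm N) - 1 / a) / (2 * a)" for N
    unfolding g sum_divide_distrib[symmetric] sum_subtractf sum_half_shift_up sum_half_shift_down idx step
    by (rule arg_cong2[where f = "(/)"]) simp_all
  moreover have "(\<lambda>N. ((half_harm (N + (2 * j + 1)) - half_harm N) - 1 / a) / (2 * a))
      \<longlonglongrightarrow> (0 - 1 / a) / (2 * a)"
    using a by (intro tendsto_intros half_harm_shift_tendsto) auto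
  ultimately have "(\<lambda>N. \<Sum>n<N + j. g n) \<longlonglongrightarrow> (0 - 1 / a) / (2 * a)" by simp
  then have "g sums ((0 - 1 / a) / (2 * a))"
    unfolding sums_def by (rule LIMSEQ_offset)
  also have "(0 - 1 / a) / (2 * a) = - 1 / (2 * a\<^sup>2)" by (simp add: power2_eq_square)
  finally show ?thesis by (simp only: g_def a_def)
qed

text \<open>In terms of the half-integer \<open>a = j + 1/2\<close> and the integer \<open>b = n + 1\<close> this is
  \<open>1 / (a (a\<^sup>2 - b\<^sup>2))\<close>.\<close>
definition double_kernel :: "nat \<Rightarrow> nat \<Rightarrow> real" where
  "double_kernel j n = 1 / ((real j + 1 / 2) * ((real j + 1 / 2)\<^sup>2 - (real (Suc n))\<^sup>2))"

text \<open>The partial fractions have the poles \<open>b\<close>, \<open>-b\<close> and \<open>0\<close> in \<open>a\<close>, with residues summing to zero. The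
  three harmonic sums therefore cancel in the limit, and what is left are the \<open>b\<close> initial terms that
  each of the shifts by \<open>\<plusminus> b\<close> displaces.\<close>
lemma sums_over_half_integers:
  "(\<lambda>j. double_kernel j n) sums (- half_harm (Suc n) / (real (Suc n))\<^sup>2)"
proof -
  define b where "b = Suc n"
  have b: "real b > 0" by (simp add: b_def)
  have g: "double_kernel j n = ((1 / (real j + 1 / 2 - real b) + 1 / (real j + 1 / 2 + real b)) / 2 - 1 / (real j + 1 / 2))
      / (real b)\<^sup>2" for j
  proof -
    define a where "a = real j + 1 / 2"
    have a: "a > 0" "a \<noteq> real b" using half_integer_neq_nat[of j b] by (auto simp: a_def)
    have "1 / (a * (a\<^sup>2 - (real b)\<^sup>2)) = ((1 / (a - real b) + 1 / (a + real b)) / 2 - 1 / a) / (real b)\<^sup>2"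
    proof -
      have "a\<^sup>2 - (real b)\<^sup>2 = (a - real b) * (a + real b)" by (simp add: power2_eq_square algebra_simps)
      moreover have "a - real b \<noteq> 0" "a + real b \<noteq> 0" using a b by auto
      ultimately show ?thesis using a b
        by (simp add: divide_simps) (simp add: power2_eq_square algebra_simps)
    qed
    then show ?thesis by (simp only: double_kernel_def a_def b_def)
  qed
  define h where "h = (\<lambda>N. half_harm (N + 2 * b) - half_harm N)"
  define h' where "h' = (\<lambda>N. half_harm (N + b) - half_harm N)"
  have bb: "b + (N + b) = N + 2 * b" for N by simp
  have "(\<Sum>j<N + b. double_kernel j n) = (h N / 2 - h' N - half_harm b) / (real b)\<^sup>2" for N
    unfolding g sum_divide_distrib[symmetric] sum_subtractf sum.distrib sum_half_shift_up sum_half_shift_down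
      half_harm_def[symmetric] h_def h'_def bb
    by (simp add: field_simps)
  moreover have "(\<lambda>N. (h N / 2 - h' N - half_harm b) / (real b)\<^sup>2) \<longlonglongrightarrow> (0 / 2 - 0 - half_harm b) / (real b)\<^sup>2"
    unfolding h_def h'_def using b by (intro tendsto_intros half_harm_shift_tendsto) auto
  ultimately have "(\<lambda>N. \<Sum>j<N + b. double_kernel j n) \<longlonglongrightarrow> (0 / 2 - 0 - half_harm b) / (real b)\<^sup>2" by simp
  then have "(\<lambda>j. double_kernel j n) sums ((0 / 2 - 0 - half_harm b) / (real b)\<^sup>2)"
    unfolding sums_def by (rule LIMSEQ_offset)
  then show ?thesis by (simp add: b_def)
qed

section \<open>Absolute convergence and exchange of summation\<close>

lemma has_sum_product_real:
  fixes x :: "'a \<Rightarrow> real" and y :: "'b \<Rightarrow> real"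
  assumes x: "(x has_sum X) A" and y: "(y has_sum Y) B"
    and nonneg: "\<And>i. i \<in> A \<Longrightarrow> x i \<ge> 0" "\<And>j. j \<in> B \<Longrightarrow> y j \<ge> 0"
  shows "((\<lambda>(i, j). x i * y j) has_sum (X * Y)) (A \<times> B)"
proof -
  have rows: "((\<lambda>j. x i * y j) has_sum (x i * Y)) B" for i
    by (rule has_sum_cmult_right[OF y])
  have cols: "((\<lambda>i. x i * Y) has_sum (X * Y)) A"
    by (rule has_sum_cmult_left[OF x])
  have "(\<lambda>(i, j). x i * y j) summable_on A \<times> B"
    using rows has_sum_imp_summable[OF cols] nonneg by (intro summable_on_SigmaI) auto
  then show ?thesis
    using rows cols by (intro has_sum_SigmaI) auto
qed

lemma has_sum_finite_sum:
  fixes f :: "'i \<Rightarrow> 'a \<Rightarrow> real"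
  assumes "\<And>i. i \<in> I \<Longrightarrow> (f i has_sum s i) A"
  shows "((\<lambda>x. \<Sum>i\<in>I. f i x) has_sum (\<Sum>i\<in>I. s i)) A"
  using assms by (induction I rule: infinite_finite_induct) (auto intro: has_sum_add)

text \<open>With \<open>d = \<bar>a - b\<bar>\<close> the kernel has modulus \<open>1 / (a d (a + b))\<close>, and \<open>a + b\<close> exceeds both \<open>a\<close> and
  \<open>d\<close>, hence also their geometric mean. So the kernel is dominated by the product of
  \<open>a powr (-3/2)\<close> and \<open>d powr (-3/2)\<close>. Passing from \<open>(a, b)\<close> to \<open>(a, a - b)\<close> is injective, and both
  factors are summable over all half-integers, positive or negative.\<close>
lemma double_kernel_summable: "(\<lambda>(j, n). double_kernel j n) summable_on UNIV"
proof -
  define w where "w = (\<lambda>r. 1 / (r * sqrt r))"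
  define x where "x = (\<lambda>j::nat. w (real j + 1 / 2))"
  define y where "y = (\<lambda>d::int. w \<bar>real_of_int d + 1 / 2\<bar>)"
  have "summable (\<lambda>n. real n powr (- (3 / 2)))" by (simp add: summable_real_powr_iff)
  then have "summable x"
  proof (rule summable_comparison_test_ev[rotated])
    show "\<forall>\<^sub>F n in sequentially. norm (x n) \<le> real n powr (- (3 / 2))"
      using eventually_gt_at_top[of 0]
    proof eventually_elim
      case (elim n)
      have "real n powr (3 / 2) = real n * sqrt (real n)"
        using elim powr_add[of "real n" 1 "1/2"] by (simp add: powr_half_sqrt)
      moreover have "real n * sqrt (real n) \<le> (real n + 1 / 2) * sqrt (real n + 1 / 2)"
        by (intro mult_mono) auto
      ultimately show ?case
        using elim by (simp add: x_def w_def powr_minus divide_simps)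
    qed
  qed
  then have xs: "x summable_on UNIV"
    by (intro summable_nonneg_imp_summable_on) (auto simp: x_def w_def)
  have "y summable_on range int"
    by (subst summable_on_reindex) (use xs in \<open>auto simp: o_def y_def x_def\<close>)
  moreover have "y summable_on range (\<lambda>n. - int n - 1)"
  proof (subst summable_on_reindex)
    have "y (- int n - 1) = x n" for n
    proof -
      have "\<bar>real_of_int (- int n - 1) + 1 / 2\<bar> = real n + 1 / 2" by simp
      then show ?thesis by (simp only: y_def x_def)
    qed
    then show "(y \<circ> (\<lambda>n. - int n - 1)) summable_on UNIV" using xs by (simp add: o_def)
  qed (auto simp: inj_on_def)
  ultimately have "y summable_on (range int \<union> range (\<lambda>n. - int n - 1))"
    by (rule summable_on_union)
  moreover have "range int \<union> range (\<lambda>n. - int n - 1) = UNIV"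
  proof -
    have "d \<in> range int \<union> range (\<lambda>n. - int n - 1)" for d
    proof (cases "d \<ge> 0")
      case True then show ?thesis by (auto intro!: image_eqI[of _ _ "nat d"])
    next
      case False then show ?thesis by (auto intro!: image_eqI[of _ _ "nat (- d - 1)"])
    qed
    then show ?thesis by blast
  qed
  ultimately have ys: "y summable_on UNIV" by simp
  have xy: "(\<lambda>(i, j). x i * y j) summable_on UNIV \<times> UNIV"
    by (rule has_sum_imp_summable[OF has_sum_product_real[OF has_sum_infsum[OF xs] has_sum_infsum[OF ys]]])
       (auto simp: x_def y_def w_def)
  \<comment> \<open>With \<open>a = j + 1/2\<close> and \<open>b = n + 1\<close> the half-integer \<open>a - b\<close> is \<open>(j - n - 1) + 1/2\<close>.\<close>
  define \<phi> where "\<phi> = (\<lambda>(j::nat, n::nat). (j, int j - int n - 1))"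
  have "inj \<phi>" by (auto simp: \<phi>_def inj_on_def)
  have "((\<lambda>(i, j). x i * y j) \<circ> \<phi>) summable_on UNIV"
    by (subst summable_on_reindex[symmetric, OF \<open>inj \<phi>\<close>], rule summable_on_subset_banach[OF xy]) auto
  then have "(\<lambda>p. norm ((\<lambda>(j, n). double_kernel j n) p)) summable_on UNIV"
  proof (rule Infinite_Sum.abs_summable_on_comparison_test')
    fix p :: "nat \<times> nat"
    obtain j n where p: "p = (j, n)" by (cases p)
    define a where "a = real j + 1 / 2"
    define b where "b = real (Suc n)"
    have ab: "a > 0" "b > 0" "a \<noteq> b" using half_integer_neq_nat[of j "Suc n"] by (auto simp: a_def b_def)
    define d where "d = \<bar>a - b\<bar>"
    have d: "d > 0" "d \<le> a + b" using ab by (auto simp: d_def)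
    have "y (int j - int n - 1) = w d" by (simp add: y_def d_def a_def b_def algebra_simps)
    moreover have "x j = w a" by (simp add: x_def a_def)
    moreover have "\<bar>double_kernel j n\<bar> = 1 / (a * (d * (a + b)))"
    proof -
      have "double_kernel j n = 1 / (a * ((a - b) * (a + b)))"
        unfolding double_kernel_def a_def[symmetric] b_def[symmetric] by (simp add: power2_eq_square algebra_simps)
      then show ?thesis using ab by (simp add: abs_mult d_def)
    qed
    moreover have "1 / (a * (d * (a + b))) \<le> w a * w d"
    proof -
      have "sqrt a * sqrt d \<le> sqrt (a + b) * sqrt (a + b)"
        using ab d by (intro mult_mono) auto
      then have "sqrt a * sqrt d \<le> a + b" using ab by simp
      then have "a * d * (sqrt a * sqrt d) \<le> a * d * (a + b)"
        using ab d by (intro mult_left_mono) auto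
      moreover have "w a * w d = 1 / (a * d * (sqrt a * sqrt d))" by (simp add: w_def)
      ultimately show ?thesis using ab d
        by (simp add: mult.assoc[symmetric]) (intro divide_left_mono mult_pos_pos; simp)
    qed
    ultimately show "norm ((\<lambda>(j, n). double_kernel j n) p) \<le> ((\<lambda>(i, j). x i * y j) \<circ> \<phi>) p"
      by (simp add: p \<phi>_def)
  qed
  then show ?thesis by (rule abs_summable_summable)
qed

lemma double_kernel_weighted_summable:
  assumes "\<And>p. \<bar>c p\<bar> \<le> C"
  shows "(\<lambda>p. c p * double_kernel (fst p) (snd p)) summable_on UNIV"
proof -
  have "(\<lambda>p. C * norm (double_kernel (fst p) (snd p))) summable_on UNIV"
    using double_kernel_summable summable_on_iff_abs_summable_on_real[of "\<lambda>(j, n). double_kernel j n"]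
    by (intro summable_on_cmult_right) (simp add: case_prod_unfold)
  then have "(\<lambda>p. norm (c p * double_kernel (fst p) (snd p))) summable_on UNIV"
    by (rule Infinite_Sum.abs_summable_on_comparison_test')
       (use assms in \<open>auto simp: abs_mult intro!: mult_right_mono\<close>)
  then show ?thesis by (rule abs_summable_summable)
qed

text \<open>Fubini for series, with the inner sums given as limits of partial sums in the natural order,
  which is the form in which telescoping delivers them.\<close>
lemma has_sum_iterated:
  fixes f :: "nat \<times> nat \<Rightarrow> real"
  assumes f: "f summable_on UNIV"
  shows "(\<And>j. (\<lambda>n. f (j, n)) sums g j) \<Longrightarrow> (g has_sum infsum f UNIV) UNIV"
    and "(\<And>n. (\<lambda>j. f (j, n)) sums h n) \<Longrightarrow> (h has_sum infsum f UNIV) UNIV"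
proof -
  have f': "f summable_on UNIV \<times> UNIV" using f by simp
  have row: "(g has_sum infsum f UNIV) UNIV"
    if f: "f summable_on (UNIV \<times> UNIV)" and s: "\<And>j. (\<lambda>n. f (j, n)) sums g j"
    for f :: "nat \<times> nat \<Rightarrow> real" and g
  proof (rule has_sum_SigmaD[of f])
    show "(f has_sum infsum f UNIV) (UNIV \<times> UNIV)"
      using f by simp
    fix j
    have "(\<lambda>n. f (j, n)) summable_on UNIV"
      using summable_on_SigmaD1[of "curry f" UNIV "\<lambda>_. UNIV" j] f by (simp add: curry_def case_prod_unfold)
    then show "((\<lambda>n. f (j, n)) has_sum g j) UNIV"
      using has_sum_imp_sums[OF has_sum_infsum] sums_unique2[OF _ s[of j]] has_sum_infsum by metis
  qed
  show "(\<And>j. (\<lambda>n. f (j, n)) sums g j) \<Longrightarrow> (g has_sum infsum f UNIV) UNIV"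
    using row[OF f'] by blast
  assume h: "\<And>n. (\<lambda>j. f (j, n)) sums h n"
  have "bij_betw prod.swap (UNIV::(nat\<times>nat) set) UNIV" by simp
  from infsum_reindex_bij_betw[OF this, of f] summable_on_reindex_bij_betw[OF this, of f] f
  have "(\<lambda>p. f (prod.swap p)) summable_on UNIV \<times> UNIV"
    "infsum (\<lambda>p. f (prod.swap p)) UNIV = infsum f UNIV" by auto
  then show "(h has_sum infsum f UNIV) UNIV"
    using row[of "\<lambda>p. f (prod.swap p)" h] h by simp
qed

section \<open>The odd harmonic series\<close>

text \<open>A geometric sum with ratio \<open>b\<^sup>2 / a\<^sup>2\<close>.\<close>
lemma geometric_sum_double_kernel:
  fixes a b :: real
  assumes "a > 0" "b > 0" "a \<noteq> b" "m \<ge> 1"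
  shows "(\<Sum>k=1..<m. 1 / a ^ (2 * k + 1) * (1 / b ^ (2 * (m - k))))
    = (1 / b ^ (2 * (m - 1)) - 1 / a ^ (2 * (m - 1))) * (1 / (a * (a\<^sup>2 - b\<^sup>2)))"
  using \<open>m \<ge> 1\<close>
proof (induction m rule: nat_induct_at_least)
  case base
  then show ?case by simp
next
  case (Suc m)
  have "a\<^sup>2 - b\<^sup>2 \<noteq> 0" using assms by (simp add: power2_eq_iff)
  have "(\<Sum>k=1..<Suc m. 1 / a ^ (2 * k + 1) * (1 / b ^ (2 * (Suc m - k))))
    = (\<Sum>k=1..<m. 1 / a ^ (2 * k + 1) * (1 / b ^ (2 * (m - k)))) / b\<^sup>2 + 1 / a ^ (2 * m + 1) * (1 / b\<^sup>2)"
  proof -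
    have shift: "1 / a ^ (2 * k + 1) * (1 / b ^ (2 * (Suc m - k))) = 1 / a ^ (2 * k + 1) * (1 / b ^ (2 * (m - k))) / b\<^sup>2"
      if "k \<in> {1..<m}" for k
    proof -
      have "2 * (Suc m - k) = 2 * (m - k) + 2" using that by auto
      then show ?thesis by (simp only: power_add) simp
    qed
    have "(\<Sum>k=1..<m. 1 / a ^ (2 * k + 1) * (1 / b ^ (2 * (Suc m - k))))
        = (\<Sum>k=1..<m. 1 / a ^ (2 * k + 1) * (1 / b ^ (2 * (m - k)))) / b\<^sup>2"
      unfolding sum_divide_distrib by (rule sum.cong[OF refl shift])
    then show ?thesis using Suc.hyps by simp
  qed
  also have "\<dots> = (1 / b ^ (2 * (m - 1)) - 1 / a ^ (2 * (m - 1))) * (1 / (a * (a\<^sup>2 - b\<^sup>2))) / b\<^sup>2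
      + 1 / a ^ (2 * m + 1) * (1 / b\<^sup>2)"
    by (simp only: Suc.IH)
  also have "\<dots> = (1 / b ^ (2 * m) - 1 / a ^ (2 * m)) * (1 / (a * (a\<^sup>2 - b\<^sup>2)))"
  proof -
    obtain l where l: "m = Suc l" using Suc.hyps by (cases m) auto
    define A where "A = a ^ (2 * l)"
    define B where "B = b ^ (2 * l)"
    have "a ^ (2 * m) = A * a\<^sup>2" "b ^ (2 * m) = B * b\<^sup>2" "a ^ (2 * m + 1) = A * a\<^sup>2 * a"
      by (simp_all add: A_def B_def l power2_eq_square)
    moreover have "A \<noteq> 0" "B \<noteq> 0" using assms by (auto simp: A_def B_def)
    moreover have "a ^ (2 * (m - 1)) = A" "b ^ (2 * (m - 1)) = B" by (simp_all add: A_def B_def l)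
    ultimately show ?thesis using \<open>a\<^sup>2 - b\<^sup>2 \<noteq> 0\<close> assms
      by (simp add: divide_simps) (simp add: algebra_simps)
  qed
  finally show ?case by simp
qed

definition zeta_real :: "nat \<Rightarrow> real" where
  "zeta_real p = (\<Sum>n. 1 / real (Suc n) ^ p)"

lemma zeta_real_sums: "p \<ge> 2 \<Longrightarrow> (\<lambda>n. 1 / real (Suc n) ^ p) sums zeta_real p"
  using inverse_power_summable[of p, where 'a = real] summable_Suc_iff[of "\<lambda>n. inverse (real n ^ p)"]
  unfolding zeta_real_def by (intro summable_sums) (simp add: field_simps)

text \<open>The sum over half-integers is \<open>2 ^ p\<close> times the odd part of the zeta series, and the even part
  is \<open>2\<^sup>-\<^sup>p\<close> times the whole series.\<close>
lemma half_integer_sums: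
  assumes "p \<ge> 2"
  shows "(\<lambda>j. 1 / (real j + 1 / 2) ^ p) sums ((2 ^ p - 1) * zeta_real p)"
proof -
  have "(\<lambda>n. \<Sum>i\<in>{n * 2..<n * 2 + 2}. 1 / real (Suc i) ^ p) sums zeta_real p"
    by (rule sums_group[OF zeta_real_sums[OF assms]]) simp
  moreover have "(\<Sum>i\<in>{n * 2..<n * 2 + 2}. 1 / real (Suc i) ^ p)
      = (1 / (real n + 1 / 2) ^ p + 1 / real (Suc n) ^ p) / 2 ^ p" for n
  proof -
    have "{n * 2..<n * 2 + 2} = {2 * n, 2 * n + 1}" by auto
    then have "(\<Sum>i\<in>{n * 2..<n * 2 + 2}. 1 / real (Suc i) ^ p)
        = 1 / real (Suc (2 * n)) ^ p + 1 / real (Suc (2 * n + 1)) ^ p"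
      by (simp only:) simp
    also have "real (Suc (2 * n)) = 2 * (real n + 1 / 2)" by simp
    also have "real (Suc (2 * n + 1)) = 2 * real (Suc n)" by simp
    finally show ?thesis
      by (simp only: power_mult_distrib add_divide_distrib divide_divide_eq_left mult.commute)
  qed
  ultimately have "(\<lambda>n. (1 / (real n + 1 / 2) ^ p + 1 / real (Suc n) ^ p) / 2 ^ p) sums zeta_real p" by simp
  from sums_diff[OF sums_mult[OF this, of "2 ^ p"] zeta_real_sums[OF assms]]
  have "(\<lambda>n. 1 / (real n + 1 / 2) ^ p) sums (2 ^ p * zeta_real p - zeta_real p)"
    by simp
  then show ?thesis by (simp only: left_diff_distrib mult_1_left)
qed

text \<open>The double series over \<open>P - Q\<close> is evaluated in two ways: as a finite sum of products of single
  series, and as the sum of \<open>P\<close> by columns minus the sum of \<open>Q\<close> by rows, where the telescoping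
  sums apply.\<close>
lemma odd_harm_series:
  assumes "m \<ge> 1"
  shows "(\<lambda>n. odd_harm (Suc n) / real (Suc n) ^ (2 * m)) sums
    ((2 ^ (2 * m + 1) - 1) * zeta_real (2 * m + 1) / 4
      - (\<Sum>k=1..<m. (2 ^ (2 * k + 1) - 1) * zeta_real (2 * k + 1) * zeta_real (2 * (m - k))) / 2)"
proof -
  define a where "a = (\<lambda>j. real j + 1 / 2)"
  define b where "b = (\<lambda>n. real (Suc n))"
  have pos: "a j > 0" "b n > 0" "a j \<noteq> b n" for j n
    using half_integer_neq_nat[of j "Suc n"] by (auto simp: a_def b_def)
  define P where "P = (\<lambda>p. 1 / b (snd p) ^ (2 * (m - 1)) * double_kernel (fst p) (snd p))"
  define Q where "Q = (\<lambda>p. 1 / a (fst p) ^ (2 * (m - 1)) * double_kernel (fst p) (snd p))"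
  have P: "P summable_on UNIV"
    unfolding P_def by (rule double_kernel_weighted_summable[of _ 1]) (simp add: b_def)
  \<comment> \<open>The smallest half-integer is \<open>1/2\<close>, so the weight is at most \<open>2 ^ (2 * (m - 1))\<close>.\<close>
  have Q: "Q summable_on UNIV"
    unfolding Q_def
  proof (rule double_kernel_weighted_summable[of _ "2 ^ (2 * (m - 1))"])
    fix p :: "nat \<times> nat"
    have "(1 / a (fst p)) ^ (2 * (m - 1)) \<le> 2 ^ (2 * (m - 1))"
      by (intro power_mono) (auto simp: a_def divide_simps)
    then show "\<bar>1 / a (fst p) ^ (2 * (m - 1))\<bar> \<le> 2 ^ (2 * (m - 1))"
      using pos(1)[of "fst p"] by (simp add: power_one_over)
  qed
  have "((\<lambda>n. 1 / b n ^ (2 * (m - 1)) * (- half_harm (Suc n) / (b n)\<^sup>2)) has_sum infsum P UNIV) UNIV"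
    by (rule has_sum_iterated(2)[OF P])
       (unfold P_def b_def fst_conv snd_conv, intro sums_mult sums_over_half_integers)
  moreover have "1 / b n ^ (2 * (m - 1)) * (- half_harm (Suc n) / (b n)\<^sup>2) = - 2 * (odd_harm (Suc n) / b n ^ (2 * m))" for n
  proof -
    have "2 * m = 2 * (m - 1) + 2" using assms by simp
    then have "b n ^ (2 * m) = b n ^ (2 * (m - 1)) * (b n)\<^sup>2" by (metis power_add)
    then show ?thesis by (simp add: half_harm_eq)
  qed
  ultimately have PS: "(\<lambda>n. - 2 * (odd_harm (Suc n) / b n ^ (2 * m))) sums infsum P UNIV"
    by (simp add: has_sum_imp_sums)
  have "((\<lambda>j. 1 / a j ^ (2 * (m - 1)) * (1 / a j * (- 1 / (2 * (a j)\<^sup>2)))) has_sum infsum Q UNIV) UNIV"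
  proof (rule has_sum_iterated(1)[OF Q])
    fix j
    have "double_kernel j = (\<lambda>n. 1 / a j * (1 / ((a j)\<^sup>2 - (real (Suc n))\<^sup>2)))"
      by (simp add: fun_eq_iff double_kernel_def a_def)
    then show "(\<lambda>n. Q (j, n)) sums (1 / a j ^ (2 * (m - 1)) * (1 / a j * (- 1 / (2 * (a j)\<^sup>2))))"
      unfolding Q_def fst_conv snd_conv a_def
      by (simp only:) (intro sums_mult sums_over_integers)
  qed
  moreover have "1 / a j ^ (2 * (m - 1)) * (1 / a j * (- 1 / (2 * (a j)\<^sup>2))) = - 1 / 2 * (1 / a j ^ (2 * m + 1))" for j
  proof -
    have "2 * m = 2 * (m - 1) + 2" using assms by simp
    then have "a j ^ (2 * m) = a j ^ (2 * (m - 1)) * (a j)\<^sup>2" by (metis power_add)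
    then show ?thesis by simp
  qed
  ultimately have "((\<lambda>j. - 1 / 2 * (1 / a j ^ (2 * m + 1))) has_sum infsum Q UNIV) UNIV"
    by (simp only:)
  then have "(\<lambda>j. - 1 / 2 * (1 / a j ^ (2 * m + 1))) sums infsum Q UNIV"
    by (rule has_sum_imp_sums)
  moreover have "(\<lambda>j. - 1 / 2 * (1 / a j ^ (2 * m + 1))) sums (- 1 / 2 * ((2 ^ (2 * m + 1) - 1) * zeta_real (2 * m + 1)))"
    unfolding a_def using assms by (intro sums_mult half_integer_sums) simp
  ultimately have QS: "infsum Q UNIV = - 1 / 2 * ((2 ^ (2 * m + 1) - 1) * zeta_real (2 * m + 1))"
    by (rule sums_unique2)
  have "((\<lambda>p. \<Sum>k=1..<m. (case p of (j, n) \<Rightarrow> 1 / a j ^ (2 * k + 1) * (1 / b n ^ (2 * (m - k))))) has_sum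
      (\<Sum>k=1..<m. (2 ^ (2 * k + 1) - 1) * zeta_real (2 * k + 1) * zeta_real (2 * (m - k)))) (UNIV \<times> UNIV)"
  proof (intro has_sum_finite_sum has_sum_product_real sums_nonneg_imp_has_sum)
    fix k assume k: "k \<in> {1..<m}"
    show "(\<lambda>j. 1 / a j ^ (2 * k + 1)) sums ((2 ^ (2 * k + 1) - 1) * zeta_real (2 * k + 1))"
      unfolding a_def using k by (intro half_integer_sums) auto
    show "(\<lambda>n. 1 / b n ^ (2 * (m - k))) sums zeta_real (2 * (m - k))"
      unfolding b_def using k by (intro zeta_real_sums) auto
  qed (auto simp: a_def b_def)
  moreover have "(\<Sum>k=1..<m. (case p of (j, n) \<Rightarrow> 1 / a j ^ (2 * k + 1) * (1 / b n ^ (2 * (m - k))))) = P p - Q p" for p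
  proof -
    have "P p - Q p = (1 / b (snd p) ^ (2 * (m - 1)) - 1 / a (fst p) ^ (2 * (m - 1))) * double_kernel (fst p) (snd p)"
      by (simp only: P_def Q_def left_diff_distrib)
    also have "double_kernel (fst p) (snd p) = 1 / (a (fst p) * ((a (fst p))\<^sup>2 - (b (snd p))\<^sup>2))"
      by (simp only: double_kernel_def a_def b_def)
    finally show ?thesis
      using geometric_sum_double_kernel[OF pos assms, of "fst p" "snd p"] by (simp only: case_prod_unfold)
  qed
  moreover have "((\<lambda>p. P p - Q p) has_sum (infsum P UNIV - infsum Q UNIV)) UNIV"
    using has_sum_add[OF has_sum_infsum[OF P] has_sum_uminusI[OF has_sum_infsum[OF Q]]] by simp
  ultimately have "(\<Sum>k=1..<m. (2 ^ (2 * k + 1) - 1) * zeta_real (2 * k + 1) * zeta_real (2 * (m - k)))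
      = infsum P UNIV - infsum Q UNIV"
    by (auto intro: has_sum_unique)
  with QS have eq: "infsum P UNIV = (\<Sum>k=1..<m. (2 ^ (2 * k + 1) - 1) * zeta_real (2 * k + 1) * zeta_real (2 * (m - k)))
      - (2 ^ (2 * m + 1) - 1) * zeta_real (2 * m + 1) / 2" by simp
  have "- 1 / 2 * (- 2 * x) = x" "- 1 / 2 * (x - y / 2) = y / 4 - x / 2" for x y :: real
    by (simp_all add: diff_divide_distrib)
  then show ?thesis
    using sums_mult[OF PS, of "- 1 / 2"] by (simp only: eq b_def)
qed

theorem corollary2p4:
  fixes m :: nat
  assumes "m \<ge> 1"
  shows "zeta_h (2 * of_nat m) =
    - (1 / 2) * (\<Sum>k=1..m. (2 ^ (2 * k + 1) - 1) *
        riemann_zeta (2 * of_nat m - 2 * of_nat k) * riemann_zeta (2 * of_nat k + 1))"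
proof -
  have zeta: "riemann_zeta (of_nat p) = of_real (zeta_real p)" if "p \<ge> 2" for p
  proof -
    have "of_nat (Suc n) powr of_nat p = (of_real (real (Suc n) ^ p) :: complex)" for n
      by (simp add: powr_nat' del: of_nat_Suc)
    then have "riemann_zeta (of_nat p) = (\<Sum>n. of_real (1 / real (Suc n) ^ p))"
      using that by (subst riemann_zeta_eq_series) (auto simp: zeta_series_def simp del: of_nat_Suc)
    also have "\<dots> = of_real (zeta_real p)"
      by (rule sums_unique[symmetric]) (rule sums_of_real[OF zeta_real_sums[OF that]])
    finally show ?thesis .
  qed
  define S where "S = (\<Sum>k=1..<m. (2 ^ (2 * k + 1) - 1) * zeta_real (2 * k + 1) * zeta_real (2 * (m - k)))"
  have "zeta_h (2 * of_nat m) = (\<Sum>n. complex_of_real (odd_harm (Suc n) / real (Suc n) ^ (2 * m)))"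
  proof -
    have "of_nat (Suc n) powr (2 * of_nat m) = (of_real (real (Suc n) ^ (2 * m)) :: complex)" for n
      using assms(1) powr_nat'[of "of_nat (Suc n) :: complex" "2 * m"] by (simp del: of_nat_Suc)
    then show ?thesis by (simp add: zeta_h_def del: of_nat_Suc)
  qed
  also have "\<dots> = of_real ((2 ^ (2 * m + 1) - 1) * zeta_real (2 * m + 1) / 4 - S / 2)"
    unfolding S_def by (rule sums_unique[symmetric]) (rule sums_of_real[OF odd_harm_series[OF assms(1)]])
  also have "\<dots> = - (1 / 2) * ((2 ^ (2 * m + 1) - 1) * (- 1 / 2) * of_real (zeta_real (2 * m + 1)) + of_real S)"
    by (simp add: field_simps)
  also have "(2 ^ (2 * m + 1) - 1) * (- 1 / 2) * complex_of_real (zeta_real (2 * m + 1)) + of_real S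
     = (\<Sum>k=1..m. (2 ^ (2 * k + 1) - 1) *
        riemann_zeta (2 * of_nat m - 2 * of_nat k) * riemann_zeta (2 * of_nat k + 1))"
  proof -
    have odd: "riemann_zeta (2 * of_nat k + 1) = of_real (zeta_real (2 * k + 1))" if "k \<ge> 1" for k
      using zeta[of "2 * k + 1"] that by (simp add: add.commute)
    have even: "riemann_zeta (2 * of_nat m - 2 * of_nat k) = of_real (zeta_real (2 * (m - k)))" if "k < m" for k
      using zeta[of "2 * (m - k)"] that by (simp add: of_nat_diff algebra_simps)
    have "(\<Sum>k=1..<m. (2 ^ (2 * k + 1) - 1) *
        riemann_zeta (2 * of_nat m - 2 * of_nat k) * riemann_zeta (2 * of_nat k + 1)) = of_real S"
      unfolding S_def of_real_sum
    proof (rule sum.cong[OF refl])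
      fix k assume "k \<in> {1..<m}"
      then have k: "k \<ge> 1" "k < m" by auto
      show "(2 ^ (2 * k + 1) - 1) * riemann_zeta (2 * of_nat m - 2 * of_nat k) * riemann_zeta (2 * of_nat k + 1)
        = of_real ((2 ^ (2 * k + 1) - 1) * zeta_real (2 * k + 1) * zeta_real (2 * (m - k)))"
        unfolding odd[OF k(1)] even[OF k(2)] by simp
    qed
    \<comment> \<open>The term \<open>k = m\<close> carries the factor \<open>zeta(0) = -1/2\<close>.\<close>
    moreover have "{1..m} = insert m {1..<m}" using assms by auto
    ultimately show ?thesis
      using odd[OF assms(1)] by (simp add: riemann_zeta_0)
  qed
  finally show ?thesis .
qed

end
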